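(* Let $(X_i,* )$, $1\le i\le m$, be power couples, let $K$ be a simplicial complex on $[m]$, and let $c$ be a minimal power sequence. Then $\eta(K)\colon(\underline{X},\underline{*})^K\to(\underline{X},\underline{*})^{K,c}$ is the identity map.
   Context: Conventions. Spaces are compactly generated, products are taken in that category, and maps are pointed. $\mathbb{N}=\{1,2,\dots\}$, $[m]=\{1,\dots,m\}$, $\Delta^{m-1}$ is the simplicial complex of all subsets of $[m]$ including $\emptyset$; a simplicial complex on $[m]$ contains $\emptyset$ and may have ghost vertices. Power couples. A pair $(X,A)$ is a pointed space $X$ with a subspace $A$ containing the basepoint. A power couple is a pair with maps of pairs $\rho_a\colon(X,A)\to(X,A)$, $a\in\mathbb{N}$, such that $\rho_1=\mathrm{id}$ and $\rho_a\circ\rho_b=\rho_{ab}$. Polyhedral products. $(\underline{X},\underline{A})^\sigma=\{(x_i)\in\prod_i X_i\mid x_i\in A_i\text{ if }i\notin\sigma\}$ and $(\underline{X},\underline{A})^K=\bigcup_{\sigma\in K}(\underline{X},\underline{A})^\sigma$. Here all $A_i=*$. Power sequences. A power sequence is a map $c\colon\Delta^{m-1}\to\mathbb{N}^m$, $\sigma\mapsto(c_1^\sigma,\dots,c_m^\sigma)$, with $c_i^\sigma=1$ for $i\notin\sigma$ and $c_i^\tau\mid c_i^\sigma$ whenever $\tau\subseteq\sigma$. It is minimal if $c_i^\sigma=c_i^{\{i\}}$ for all $\sigma$ and all $i\in\sigma$ (and $c_i^\sigma=1$ if $i\notin\sigma$). For $\tau\subseteq\sigma$, $\underline{c}^{\sigma/\tau}$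 is the self-map of any $(\underline{X},\underline{A})^K$ obtained by restricting $\prod_i\rho_{c_i^\sigma/c_i^\tau}$. Weighted polyhedral products. Spaces $(\underline{X},\underline{A})^{\sigma,c}$ and maps $\eta(\sigma)\colon(\underline{X},\underline{A})^\sigma\to(\underline{X},\underline{A})^{\sigma,c}$ are defined by induction on $|\sigma|$, forming a functor on the face poset. First, $(\underline{X},\underline{A})^{\emptyset,c}=\prod_i A_i$, $\eta(\emptyset)=\mathrm{id}$. For $|\sigma|\ge1$, $(\underline{X},\underline{A})^{\partial\sigma,c}=\mathrm{colim}_{\tau\subsetneq\sigma}(\underline{X},\underline{A})^{\tau,c}$, the map $\eta(\partial\sigma)\colon(\underline{X},\underline{A})^{\partial\sigma}\to(\underline{X},\underline{A})^{\partial\sigma,c}$ is induced by the composites $(\underline{X},\underline{A})^\tau\xrightarrow{\underline{c}^{\sigma/\tau}}(\underline{X},\underline{A})^\tau\xrightarrow{\eta(\tau)}(\underline{X},\underline{A})^{\tau,c}\to(\underline{X},\underline{A})^{\partial\sigma,c}$ over $\tau\subsetneq\sigma$, and $(\underline{X},\underline{A})^{\sigma,c}$ is the pushout of the inclusion $(\underline{X},\underline{A})^{\partial\sigma}\to(\underline{X},\underline{A})^\sigma$ and $\eta(\partial\sigma)$, with $\eta(\sigma)$ the map from $(\underline{X},\underline{A})^\sigma$. $(\underline{X},\underline{A})^{K,c}=\mathrm{colim}_{\sigma\in K}(\underline{X},\underline{A})^{\sigma,c}$. If $\omega\in\Delta^{m-1}$ is the smallest simplex containing $K$, the map $\eta(K)\colon(\underline{X},\underline{A})^K\to(\underline{X},\underline{A})^{K,c}$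 is induced by the composites $(\underline{X},\underline{A})^\sigma\xrightarrow{\underline{c}^{\omega/\sigma}}(\underline{X},\underline{A})^\sigma\xrightarrow{\eta(\sigma)}(\underline{X},\underline{A})^{\sigma,c}\to(\underline{X},\underline{A})^{K,c}$ over $\sigma\in K$. Pushouts and colimits are determined only up to canonical homeomorphism; "is the identity map" means that, with the pushout of a space along an identity map taken to be that space itself and $(\underline{X},\underline{*})^K$ taken as the colimit of the $(\underline{X},\underline{*})^\sigma$, $\sigma\in K$, one has $(\underline{X},\underline{*})^{K,c}=(\underline{X},\underline{*})^K$ and $\eta(K)=\mathrm{id}$. *)

theory Defs
  imports "HOL-Analysis.Analysis"
begin

section \<open>Power couples, simplicial complexes and power sequences\<close>

text \<open>
  Spaces are compactly generated in the sense of the library predicate \<^const>\<open>k_space\<close> (no separation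
  axiom), and limits are formed in that category by means of \<^const>\<open>kification\<close>.  Index sets are
  \<open>[m] = {1..m}\<close>, and the spaces \<open>X\<^sub>1, \<dots>, X\<^sub>m\<close> are arbitrary topologies on subsets of
  a common carrier type.
\<close>

definition power_couple ::
  "'a topology \<Rightarrow> 'a set \<Rightarrow> 'a \<Rightarrow> (nat \<Rightarrow> 'a \<Rightarrow> 'a) \<Rightarrow> bool" where
  "power_couple X A pt \<rho> \<longleftrightarrow>
     k_space X \<and> A \<subseteq> topspace X \<and> pt \<in> A \<and>
     (\<forall>a\<ge>1. continuous_map X X (\<rho> a) \<and> \<rho> a ` A \<subseteq> A \<and> \<rho> a pt = pt) \<and>
     (\<forall>x\<in>topspace X. \<rho> 1 x = x) \<and>
     (\<forall>a\<ge>1. \<forall>b\<ge>1. \<forall>x\<in>topspace X. \<rho> a (\<rho> b x) = \<rho> (a * b) x)"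

definition complex_on :: "nat \<Rightarrow> nat set set \<Rightarrow> bool" where
  "complex_on m K \<longleftrightarrow>
     K \<subseteq> Pow {1..m} \<and> {} \<in> K \<and> (\<forall>\<sigma>\<in>K. \<forall>\<tau>. \<tau> \<subseteq> \<sigma> \<longrightarrow> \<tau> \<in> K)"

definition power_sequence :: "nat \<Rightarrow> (nat set \<Rightarrow> nat \<Rightarrow> nat) \<Rightarrow> bool" where
  "power_sequence m c \<longleftrightarrow>
     (\<forall>\<sigma>. \<sigma> \<subseteq> {1..m} \<longrightarrow>
        (\<forall>i\<in>{1..m}. c \<sigma> i \<ge> 1) \<and>
        (\<forall>i\<in>{1..m} - \<sigma>. c \<sigma> i = 1) \<and>
        (\<forall>\<tau>. \<tau> \<subseteq> \<sigma> \<longrightarrow> (\<forall>i\<in>{1..m}. c \<tau> i dvd c \<sigma> i)))"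

definition minimal_power_sequence :: "nat \<Rightarrow> (nat set \<Rightarrow> nat \<Rightarrow> nat) \<Rightarrow> bool" where
  "minimal_power_sequence m c \<longleftrightarrow>
     power_sequence m c \<and> (\<forall>\<sigma>. \<sigma> \<subseteq> {1..m} \<longrightarrow> (\<forall>i\<in>\<sigma>. c \<sigma> i = c {i} i))"


section \<open>Colimits over posets of faces, and pushouts\<close>

text \<open>
  Colimits are determined only up to canonical homeomorphism; the representatives used here are
  the following.  If all transition maps of a diagram \<open>W\<close> of spaces indexed by a set \<open>T\<close> of faces are
  inclusions of sets and \<open>W \<sigma> \<inter> W \<tau> = W (\<sigma> \<inter> \<tau>)\<close>, then its colimit is the union of the
  \<open>W \<tau>\<close> with the final topology.  (The inclusions need not be embeddings.)
\<close>

definition colim_top :: "'s set \<Rightarrow> ('s \<Rightarrow> 'p topology) \<Rightarrow> 'p topology" where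
  "colim_top T W = topology (\<lambda>U. U \<subseteq> (\<Union>\<tau>\<in>T. topspace (W \<tau>)) \<and>
                                   (\<forall>\<tau>\<in>T. openin (W \<tau>) (U \<inter> topspace (W \<tau>))))"

text \<open>The map out of such a colimit induced by compatible maps \<open>g \<tau>\<close> defined on the sets \<open>S \<tau>\<close>.\<close>

definition induced_map :: "'s set \<Rightarrow> ('s \<Rightarrow> 'p set) \<Rightarrow> ('s \<Rightarrow> 'p \<Rightarrow> 'q) \<Rightarrow> 'p \<Rightarrow> 'q" where
  "induced_map T S g x = (THE y. \<forall>\<tau>\<in>T. x \<in> S \<tau> \<longrightarrow> y = g \<tau> x)"

text \<open>
  The pushout of an injective inclusion \<open>B \<rightarrow> Z\<close> and a map \<open>f : B \<rightarrow> Y\<close>, where \<open>Y\<close> is disjoint from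
  \<open>Z - B\<close>: as a set it is the disjoint union of \<open>Y\<close> and \<open>Z - B\<close>, and it has the final topology with
  respect to the inclusion of \<open>Y\<close> and the map \<open>pushout_map B f\<close> from \<open>Z\<close>.  For \<open>Y = B\<close> and \<open>f\<close> the identity,
  this representative is \<open>Z\<close> itself and \<open>pushout_map B f\<close> is its identity, which is the convention
  under which the theorem is stated.  The universal properties are verified below.
\<close>

definition pushout_map :: "'p topology \<Rightarrow> ('p \<Rightarrow> 'p) \<Rightarrow> 'p \<Rightarrow> 'p" where
  "pushout_map B f z = (if z \<in> topspace B then f z else z)"

definition pushout_top ::
  "'p topology \<Rightarrow> 'p topology \<Rightarrow> ('p \<Rightarrow> 'p) \<Rightarrow> 'p topology \<Rightarrow> 'p topology" where
  "pushout_top Z B f Y =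
     topology (\<lambda>U. U \<subseteq> topspace Y \<union> (topspace Z - topspace B) \<and>
                   openin Y (U \<inter> topspace Y) \<and>
                   openin Z {z \<in> topspace Z. pushout_map B f z \<in> U})"

lemma colim_top_cong [fundef_cong]:
  assumes "T = T'" "\<And>\<tau>. \<tau> \<in> T' \<Longrightarrow> W \<tau> = W' \<tau>"
  shows "colim_top T W = colim_top T' W'"
  using assms by (simp add: colim_top_def)

lemma induced_map_cong [fundef_cong]:
  assumes "T = T'" "S = S'" "\<And>\<tau> x. \<tau> \<in> T' \<Longrightarrow> g \<tau> x = g' \<tau> x"
  shows "induced_map T S g = induced_map T' S' g'"
proof
  fix x
  have "(\<lambda>y. \<forall>\<tau>\<in>T. x \<in> S \<tau> \<longrightarrow> y = g \<tau> x) = (\<lambda>y. \<forall>\<tau>\<in>T'. x \<in> S' \<tau> \<longrightarrow> y = g' \<tau> x)"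
    using assms by auto
  then show "induced_map T S g x = induced_map T' S' g' x" by (simp add: induced_map_def)
qed


section \<open>Polyhedral products and weighted polyhedral products\<close>

definition polyhedral_set ::
  "nat \<Rightarrow> (nat \<Rightarrow> 'a topology) \<Rightarrow> (nat \<Rightarrow> 'a set) \<Rightarrow> nat set \<Rightarrow> (nat \<Rightarrow> 'a) set" where
  "polyhedral_set m X A \<sigma> =
     {x \<in> (\<Pi>\<^sub>E i\<in>{1..m}. topspace (X i)). \<forall>i\<in>{1..m} - \<sigma>. x i \<in> A i}"

text \<open>The space \<open>(X,A)\<^sup>\<sigma>\<close>, a subspace of the product in the category of compactly generated spaces.\<close>

definition polyhedral_simplex ::
  "nat \<Rightarrow> (nat \<Rightarrow> 'a topology) \<Rightarrow> (nat \<Rightarrow> 'a set) \<Rightarrow> nat set \<Rightarrow> (nat \<Rightarrow> 'a) topology" where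
  "polyhedral_simplex m X A \<sigma> =
     kification (subtopology (kification (product_topology X {1..m})) (polyhedral_set m X A \<sigma>))"

text \<open>The space \<open>(X,A)\<^sup>K\<close>, as the colimit of the \<open>(X,A)\<^sup>\<sigma>\<close> with \<open>\<sigma> \<in> K\<close>.\<close>

definition polyhedral_product ::
  "nat \<Rightarrow> (nat \<Rightarrow> 'a topology) \<Rightarrow> (nat \<Rightarrow> 'a set) \<Rightarrow> nat set set \<Rightarrow> (nat \<Rightarrow> 'a) topology" where
  "polyhedral_product m X A K = colim_top K (polyhedral_simplex m X A)"

abbreviation polyhedral_boundary ::
  "nat \<Rightarrow> (nat \<Rightarrow> 'a topology) \<Rightarrow> (nat \<Rightarrow> 'a set) \<Rightarrow> nat set \<Rightarrow> (nat \<Rightarrow> 'a) topology" where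
  "polyhedral_boundary m X A \<sigma> \<equiv> polyhedral_product m X A {\<tau>. \<tau> \<subset> \<sigma>}"

text \<open>The map \<open>c\<^sup>\<sigma>\<^sup>/\<^sup>\<tau>\<close>; all divisions are exact when \<open>\<tau> \<subseteq> \<sigma>\<close>.\<close>

definition weight_map ::
  "nat \<Rightarrow> (nat \<Rightarrow> nat \<Rightarrow> 'a \<Rightarrow> 'a) \<Rightarrow> (nat set \<Rightarrow> nat \<Rightarrow> nat) \<Rightarrow> nat set \<Rightarrow> nat set \<Rightarrow>
     (nat \<Rightarrow> 'a) \<Rightarrow> (nat \<Rightarrow> 'a)" where
  "weight_map m \<rho> c \<sigma> \<tau> x = (\<lambda>i\<in>{1..m}. \<rho> i (c \<sigma> i div c \<tau> i) (x i))"

text \<open>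
  The maps \<open>\<eta>(\<sigma>) : (X,A)\<^sup>\<sigma> \<rightarrow> (X,A)\<^sup>\<sigma>\<^sup>,\<^sup>c\<close>, the spaces \<open>(X,A)\<^sup>\<sigma>\<^sup>,\<^sup>c\<close>, and
  their versions for \<open>\<partial>\<sigma>\<close>.  Faces are finite; the case of infinite \<open>\<sigma>\<close> is only there to make
  the recursions total.  The argument \<open>induced_map \<dots>\<close> of \<open>pushout_map\<close> is \<open>\<eta>(\<partial>\<sigma>)\<close>.
\<close>

function eta_simplex ::
  "nat \<Rightarrow> (nat \<Rightarrow> 'a topology) \<Rightarrow> (nat \<Rightarrow> 'a set) \<Rightarrow> (nat \<Rightarrow> nat \<Rightarrow> 'a \<Rightarrow> 'a) \<Rightarrow>
     (nat set \<Rightarrow> nat \<Rightarrow> nat) \<Rightarrow> nat set \<Rightarrow> (nat \<Rightarrow> 'a) \<Rightarrow> (nat \<Rightarrow> 'a)" where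
  "eta_simplex m X A \<rho> c \<sigma> x =
     (if finite \<sigma> \<and> \<sigma> \<noteq> {}
      then pushout_map (polyhedral_boundary m X A \<sigma>)
             (induced_map {\<tau>. \<tau> \<subset> \<sigma>} (polyhedral_set m X A)
               (\<lambda>\<tau> y. eta_simplex m X A \<rho> c \<tau> (weight_map m \<rho> c \<sigma> \<tau> y))) x
      else x)"
  by pat_completeness auto
termination
  by (relation "Wellfounded.measure (\<lambda>(m, X, A, \<rho>, c, \<sigma>, x). card \<sigma>)") (simp_all add: psubset_card_mono)

definition eta_boundary ::
  "nat \<Rightarrow> (nat \<Rightarrow> 'a topology) \<Rightarrow> (nat \<Rightarrow> 'a set) \<Rightarrow> (nat \<Rightarrow> nat \<Rightarrow> 'a \<Rightarrow> 'a) \<Rightarrow>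
     (nat set \<Rightarrow> nat \<Rightarrow> nat) \<Rightarrow> nat set \<Rightarrow> (nat \<Rightarrow> 'a) \<Rightarrow> (nat \<Rightarrow> 'a)" where
  "eta_boundary m X A \<rho> c \<sigma> =
     induced_map {\<tau>. \<tau> \<subset> \<sigma>} (polyhedral_set m X A)
       (\<lambda>\<tau> y. eta_simplex m X A \<rho> c \<tau> (weight_map m \<rho> c \<sigma> \<tau> y))"

function weighted_simplex ::
  "nat \<Rightarrow> (nat \<Rightarrow> 'a topology) \<Rightarrow> (nat \<Rightarrow> 'a set) \<Rightarrow> (nat \<Rightarrow> nat \<Rightarrow> 'a \<Rightarrow> 'a) \<Rightarrow>
     (nat set \<Rightarrow> nat \<Rightarrow> nat) \<Rightarrow> nat set \<Rightarrow> (nat \<Rightarrow> 'a) topology" where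
  "weighted_simplex m X A \<rho> c \<sigma> =
     (if finite \<sigma> \<and> \<sigma> \<noteq> {}
      then pushout_top (polyhedral_simplex m X A \<sigma>) (polyhedral_boundary m X A \<sigma>)
             (eta_boundary m X A \<rho> c \<sigma>)
             (colim_top {\<tau>. \<tau> \<subset> \<sigma>} (\<lambda>\<tau>. weighted_simplex m X A \<rho> c \<tau>))
      else polyhedral_simplex m X A \<sigma>)"
  by pat_completeness auto
termination
  by (relation "Wellfounded.measure (\<lambda>(m, X, A, \<rho>, c, \<sigma>). card \<sigma>)") (simp_all add: psubset_card_mono)

declare eta_simplex.simps [simp del] weighted_simplex.simps [simp del]

text \<open>The space \<open>(X,A)\<^sup>K\<^sup>,\<^sup>c\<close>; for \<open>K = {\<tau>. \<tau> \<subset> \<sigma>}\<close> it is \<open>(X,A)\<^sup>\<partial>\<^sup>\<sigma>\<^sup>,\<^sup>c\<close>.\<close>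

definition weighted_product ::
  "nat \<Rightarrow> (nat \<Rightarrow> 'a topology) \<Rightarrow> (nat \<Rightarrow> 'a set) \<Rightarrow> (nat \<Rightarrow> nat \<Rightarrow> 'a \<Rightarrow> 'a) \<Rightarrow>
     (nat set \<Rightarrow> nat \<Rightarrow> nat) \<Rightarrow> nat set set \<Rightarrow> (nat \<Rightarrow> 'a) topology" where
  "weighted_product m X A \<rho> c K = colim_top K (weighted_simplex m X A \<rho> c)"

text \<open>The map \<open>\<eta>(K)\<close>; the smallest simplex containing \<open>K\<close> is \<open>\<Union>K\<close>, the set of vertices of \<open>K\<close>.\<close>

definition eta_product ::
  "nat \<Rightarrow> (nat \<Rightarrow> 'a topology) \<Rightarrow> (nat \<Rightarrow> 'a set) \<Rightarrow> (nat \<Rightarrow> nat \<Rightarrow> 'a \<Rightarrow> 'a) \<Rightarrow>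
     (nat set \<Rightarrow> nat \<Rightarrow> nat) \<Rightarrow> nat set set \<Rightarrow> (nat \<Rightarrow> 'a) \<Rightarrow> (nat \<Rightarrow> 'a)" where
  "eta_product m X A \<rho> c K =
     induced_map K (polyhedral_set m X A)
       (\<lambda>\<sigma> y. eta_simplex m X A \<rho> c \<sigma> (weight_map m \<rho> c (\<Union>K) \<sigma> y))"


section \<open>The representatives are pushouts and colimits\<close>

text \<open>
  Verification, for arbitrary power couples and power sequences, that the spaces above satisfy the
  universal properties that define weighted polyhedral products, and that the maps \<open>\<eta>\<close> exist.
\<close>

lemma openin_colim_top:
  "openin (colim_top T W) U \<longleftrightarrow>
     U \<subseteq> (\<Union>\<tau>\<in>T. topspace (W \<tau>)) \<and> (\<forall>\<tau>\<in>T. openin (W \<tau>) (U \<inter> topspace (W \<tau>)))"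
proof -
  have "istopology (\<lambda>U. U \<subseteq> (\<Union>\<tau>\<in>T. topspace (W \<tau>)) \<and>
                         (\<forall>\<tau>\<in>T. openin (W \<tau>) (U \<inter> topspace (W \<tau>))))"
    unfolding istopology_def
  proof (intro conjI allI impI ballI)
    fix S S' \<tau>
    assume *: "S \<subseteq> (\<Union>\<tau>\<in>T. topspace (W \<tau>)) \<and> (\<forall>\<tau>\<in>T. openin (W \<tau>) (S \<inter> topspace (W \<tau>)))"
      and **: "S' \<subseteq> (\<Union>\<tau>\<in>T. topspace (W \<tau>)) \<and> (\<forall>\<tau>\<in>T. openin (W \<tau>) (S' \<inter> topspace (W \<tau>)))"
      and "\<tau> \<in> T"
    have "openin (W \<tau>) ((S \<inter> topspace (W \<tau>)) \<inter> (S' \<inter> topspace (W \<tau>)))"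
      by (rule openin_Int) (use * ** \<open>\<tau> \<in> T\<close> in blast)+
    then show "openin (W \<tau>) (S \<inter> S' \<inter> topspace (W \<tau>))"
      by (simp add: Int_ac)
  next
    fix \<K> \<tau>
    assume *: "\<forall>S\<in>\<K>. S \<subseteq> (\<Union>\<tau>\<in>T. topspace (W \<tau>)) \<and>
                     (\<forall>\<tau>\<in>T. openin (W \<tau>) (S \<inter> topspace (W \<tau>)))" and "\<tau> \<in> T"
    then have "openin (W \<tau>) (\<Union>S\<in>\<K>. S \<inter> topspace (W \<tau>))"
      by (intro openin_Union) auto
    then show "openin (W \<tau>) (\<Union>\<K> \<inter> topspace (W \<tau>))"
      by (subst Int_Union2)
  qed auto
  then show ?thesis by (simp add: colim_top_def)
qed

lemma topspace_colim_top [simp]: "topspace (colim_top T W) = (\<Union>\<tau>\<in>T. topspace (W \<tau>))"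
proof
  have "openin (colim_top T W) (topspace (colim_top T W))" by blast
  then show "topspace (colim_top T W) \<subseteq> (\<Union>\<tau>\<in>T. topspace (W \<tau>))"
    unfolding openin_colim_top by blast
  have "openin (W \<tau>) ((\<Union>\<tau>\<in>T. topspace (W \<tau>)) \<inter> topspace (W \<tau>))" if "\<tau> \<in> T" for \<tau>
  proof -
    have "(\<Union>\<tau>\<in>T. topspace (W \<tau>)) \<inter> topspace (W \<tau>) = topspace (W \<tau>)" using that by blast
    then show ?thesis by simp
  qed
  then have "openin (colim_top T W) (\<Union>\<tau>\<in>T. topspace (W \<tau>))"
    unfolding openin_colim_top by blast
  then show "(\<Union>\<tau>\<in>T. topspace (W \<tau>)) \<subseteq> topspace (colim_top T W)"
    by (rule openin_subset)
qed

lemma openin_pushout_top: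
  "openin (pushout_top Z B f Y) U \<longleftrightarrow>
     U \<subseteq> topspace Y \<union> (topspace Z - topspace B) \<and> openin Y (U \<inter> topspace Y) \<and>
     openin Z {z \<in> topspace Z. pushout_map B f z \<in> U}"
proof -
  have "istopology (\<lambda>U. U \<subseteq> topspace Y \<union> (topspace Z - topspace B) \<and> openin Y (U \<inter> topspace Y) \<and>
     openin Z {z \<in> topspace Z. pushout_map B f z \<in> U})"
    unfolding istopology_def
  proof (intro conjI allI impI)
    fix S S'
    assume S: "S \<subseteq> topspace Y \<union> (topspace Z - topspace B) \<and> openin Y (S \<inter> topspace Y) \<and>
         openin Z {z \<in> topspace Z. pushout_map B f z \<in> S}"
      and S': "S' \<subseteq> topspace Y \<union> (topspace Z - topspace B) \<and> openin Y (S' \<inter> topspace Y) \<and>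
         openin Z {z \<in> topspace Z. pushout_map B f z \<in> S'}"
    have "openin Y ((S \<inter> topspace Y) \<inter> (S' \<inter> topspace Y))"
      by (rule openin_Int) (use S S' in blast)+
    then show "openin Y (S \<inter> S' \<inter> topspace Y)" by (simp add: Int_ac)
    have "openin Z ({z \<in> topspace Z. pushout_map B f z \<in> S} \<inter>
                    {z \<in> topspace Z. pushout_map B f z \<in> S'})"
      by (rule openin_Int) (use S S' in blast)+
    moreover have "{z \<in> topspace Z. pushout_map B f z \<in> S} \<inter>
        {z \<in> topspace Z. pushout_map B f z \<in> S'} = {z \<in> topspace Z. pushout_map B f z \<in> S \<inter> S'}"
      by blast
    ultimately show "openin Z {z \<in> topspace Z. pushout_map B f z \<in> S \<inter> S'}" by simp
  next
    fix \<K>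
    assume *: "\<forall>S\<in>\<K>. S \<subseteq> topspace Y \<union> (topspace Z - topspace B) \<and> openin Y (S \<inter> topspace Y) \<and>
         openin Z {z \<in> topspace Z. pushout_map B f z \<in> S}"
    have "openin Y (\<Union>S\<in>\<K>. S \<inter> topspace Y)"
      using * by (intro openin_Union) auto
    then show "openin Y (\<Union>\<K> \<inter> topspace Y)" by (subst Int_Union2)
    have "openin Z (\<Union>S\<in>\<K>. {z \<in> topspace Z. pushout_map B f z \<in> S})"
      using * by (intro openin_Union) auto
    moreover have "(\<Union>S\<in>\<K>. {z \<in> topspace Z. pushout_map B f z \<in> S}) =
        {z \<in> topspace Z. pushout_map B f z \<in> \<Union>\<K>}" by blast
    ultimately show "openin Z {z \<in> topspace Z. pushout_map B f z \<in> \<Union>\<K>}" by simp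
  qed auto
  then show ?thesis by (simp add: pushout_top_def)
qed

lemma topspace_pushout_top:
  assumes "f ` topspace B \<subseteq> topspace Y"
  shows "topspace (pushout_top Z B f Y) = topspace Y \<union> (topspace Z - topspace B)"
proof
  have "openin (pushout_top Z B f Y) (topspace (pushout_top Z B f Y))" by blast
  then show "topspace (pushout_top Z B f Y) \<subseteq> topspace Y \<union> (topspace Z - topspace B)"
    unfolding openin_pushout_top by blast
  have "(topspace Y \<union> (topspace Z - topspace B)) \<inter> topspace Y = topspace Y" by blast
  moreover have "{z \<in> topspace Z. pushout_map B f z \<in> topspace Y \<union> (topspace Z - topspace B)} = topspace Z"
    using assms by (auto simp: pushout_map_def)
  ultimately have "openin (pushout_top Z B f Y) (topspace Y \<union> (topspace Z - topspace B))"
    unfolding openin_pushout_top by simp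
  then show "topspace Y \<union> (topspace Z - topspace B) \<subseteq> topspace (pushout_top Z B f Y)"
    by (rule openin_subset)
qed

lemma continuous_map_into_colim:
  assumes "\<tau> \<in> T"
  shows "continuous_map (W \<tau>) (colim_top T W) (\<lambda>x. x)"
  unfolding continuous_map_def
proof (intro conjI allI impI)
  show "(\<lambda>x. x) \<in> topspace (W \<tau>) \<rightarrow> topspace (colim_top T W)" using assms by auto
  fix U assume "openin (colim_top T W) U"
  then have "openin (W \<tau>) (U \<inter> topspace (W \<tau>))" using assms by (simp add: openin_colim_top)
  then show "openin (W \<tau>) {x \<in> topspace (W \<tau>). x \<in> U}"
    by (simp add: Int_def conj_commute)
qed

lemma continuous_map_from_colim:
  "continuous_map (colim_top T W) V f \<longleftrightarrow> (\<forall>\<tau>\<in>T. continuous_map (W \<tau>) V f)" (is "?l \<longleftrightarrow> ?r")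
proof
  assume ?l
  then show ?r using continuous_map_compose[OF continuous_map_into_colim] by (fastforce simp: o_def)
next
  assume r: ?r
  have "openin (W \<tau>) ({x \<in> topspace (colim_top T W). f x \<in> U} \<inter> topspace (W \<tau>))"
    if "openin V U" "\<tau> \<in> T" for U \<tau>
  proof -
    have "{x \<in> topspace (colim_top T W). f x \<in> U} \<inter> topspace (W \<tau>) = {x \<in> topspace (W \<tau>). f x \<in> U}"
      using that by auto
    then show ?thesis using r that by (simp add: continuous_map_def)
  qed
  moreover have "f \<in> topspace (colim_top T W) \<rightarrow> topspace V"
    using r by (auto simp: continuous_map_def)
  ultimately show ?l by (simp add: continuous_map_def openin_colim_top) blast
qed

lemma continuous_map_into_pushout:
  assumes "f ` topspace B \<subseteq> topspace Y"
  shows "continuous_map Y (pushout_top Z B f Y) (\<lambda>x. x)"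
    and "continuous_map Z (pushout_top Z B f Y) (pushout_map B f)"
proof -
  show "continuous_map Y (pushout_top Z B f Y) (\<lambda>x. x)"
    using assms
    by (auto simp: continuous_map_def topspace_pushout_top openin_pushout_top Int_def conj_commute)
  have "pushout_map B f z \<in> topspace (pushout_top Z B f Y)" if "z \<in> topspace Z" for z
    using assms that by (auto simp: topspace_pushout_top[OF assms] pushout_map_def)
  then show "continuous_map Z (pushout_top Z B f Y) (pushout_map B f)"
    by (simp add: continuous_map_def openin_pushout_top)
qed

lemma continuous_map_from_pushout:
  assumes f: "f ` topspace B \<subseteq> topspace Y" 
  shows "continuous_map (pushout_top Z B f Y) V h \<longleftrightarrow>
     continuous_map Y V h \<and> continuous_map Z V (h \<circ> pushout_map B f)" (is "?l \<longleftrightarrow> ?r")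
proof
  assume ?l
  then show ?r using continuous_map_into_pushout[OF f]
    by (metis continuous_map_compose comp_def continuous_map_eq)
next
  assume r: ?r
  have "h \<in> topspace (pushout_top Z B f Y) \<rightarrow> topspace V"
    using r unfolding topspace_pushout_top[OF f] continuous_map_def
    by (fastforce simp: pushout_map_def Pi_iff split: if_splits)
  moreover have "openin (pushout_top Z B f Y) {x \<in> topspace (pushout_top Z B f Y). h x \<in> U}"
    if U: "openin V U" for U
  proof -
    have "{x \<in> topspace (pushout_top Z B f Y). h x \<in> U} \<inter> topspace Y = {x \<in> topspace Y. h x \<in> U}"
      by (auto simp: topspace_pushout_top[OF f])
    moreover have "{z \<in> topspace Z. pushout_map B f z \<in> {x \<in> topspace (pushout_top Z B f Y). h x \<in> U}}
        = {z \<in> topspace Z. (h \<circ> pushout_map B f) z \<in> U}"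
      using f by (auto simp: topspace_pushout_top[OF f] pushout_map_def)
    ultimately show ?thesis
      unfolding openin_pushout_top
      using r U by (auto simp: continuous_map_def topspace_pushout_top[OF f])
  qed
  ultimately show ?l by (simp add: continuous_map_def)
qed

lemma pushout_universal:
  assumes f: "f ` topspace B \<subseteq> topspace Y" and BZ: "topspace B \<subseteq> topspace Z"
    and disj: "topspace Y \<inter> (topspace Z - topspace B) = {}"
    and g: "continuous_map Y V g" and h: "continuous_map Z V h"
    and gh: "\<And>b. b \<in> topspace B \<Longrightarrow> g (f b) = h b"
  obtains k where "continuous_map (pushout_top Z B f Y) V k"
    and "\<And>y. y \<in> topspace Y \<Longrightarrow> k y = g y"
    and "\<And>z. z \<in> topspace Z \<Longrightarrow> k (pushout_map B f z) = h z"
proof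
  define k where "k x = (if x \<in> topspace Y then g x else h x)" for x
  show 1: "k y = g y" if "y \<in> topspace Y" for y using that by (simp add: k_def)
  show 2: "k (pushout_map B f z) = h z" if "z \<in> topspace Z" for z
    using that f disj gh by (auto simp: k_def pushout_map_def)
  show "continuous_map (pushout_top Z B f Y) V k"
    unfolding continuous_map_from_pushout[OF f]
    using continuous_map_eq[OF g] continuous_map_eq[OF h] 1 2 by fastforce
qed

lemma k_space_final:
  assumes "\<And>j. j \<in> J \<Longrightarrow> k_space (W j)" "\<And>j. j \<in> J \<Longrightarrow> continuous_map (W j) C (q j)"
    and "\<And>U. U \<subseteq> topspace C \<Longrightarrow> (\<And>j. j \<in> J \<Longrightarrow> openin (W j) {x \<in> topspace (W j). q j x \<in> U}) \<Longrightarrow> openin C U"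
  shows "k_space C"
  unfolding k_space_open
proof (intro allI impI)
  fix S assume S: "S \<subseteq> topspace C \<and> (\<forall>K. compactin C K \<longrightarrow> openin (subtopology C K) (K \<inter> S))"
  show "openin C S"
  proof (rule assms(3))
    fix j assume j: "j \<in> J"
    have "continuous_map (W j) (kification C) (q j)"
      using continuous_map_into_kification[OF assms(1)[OF j]] assms(2)[OF j] by blast
    moreover have "openin (kification C) S" using S by (simp add: openin_kification)
    ultimately show "openin (W j) {x \<in> topspace (W j). q j x \<in> S}"
      by (simp add: continuous_map_def)
  qed (use S in auto)
qed

lemma k_space_colim_top:
  assumes "\<And>\<tau>. \<tau> \<in> T \<Longrightarrow> k_space (W \<tau>)"
  shows "k_space (colim_top T W)"
proof (rule k_space_final[of T W _ "\<lambda>_ x. x"])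
  fix U assume "U \<subseteq> topspace (colim_top T W)"
    and "\<And>\<tau>. \<tau> \<in> T \<Longrightarrow> openin (W \<tau>) {x \<in> topspace (W \<tau>). x \<in> U}"
  then show "openin (colim_top T W) U"
    by (simp add: openin_colim_top Int_def conj_commute)
qed (use assms continuous_map_into_colim in auto)

lemma k_space_pushout_top:
  assumes f: "f ` topspace B \<subseteq> topspace Y" and "k_space Y" "k_space Z"
  shows "k_space (pushout_top Z B f Y)"
proof (rule k_space_final[of "UNIV :: bool set" "\<lambda>b. if b then Y else Z" _ "\<lambda>b. if b then (\<lambda>x. x) else pushout_map B f"])
  fix U assume "U \<subseteq> topspace (pushout_top Z B f Y)"
    and *: "\<And>b. b \<in> (UNIV :: bool set) \<Longrightarrow> openin (if b then Y else Z) {x \<in> topspace (if b then Y else Z).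
                    (if b then (\<lambda>x. x) else pushout_map B f) x \<in> U}"
  then show "openin (pushout_top Z B f Y) U"
    using *[of True] *[of False]
    by (simp add: openin_pushout_top topspace_pushout_top[OF f] Int_def conj_commute)
qed (use assms continuous_map_into_pushout[OF f] in auto)


locale weighted_data =
  fixes m :: nat and X :: "nat \<Rightarrow> 'a topology" and A :: "nat \<Rightarrow> 'a set" and pt :: "nat \<Rightarrow> 'a"
    and \<rho> :: "nat \<Rightarrow> nat \<Rightarrow> 'a \<Rightarrow> 'a" and c :: "nat set \<Rightarrow> nat \<Rightarrow> nat"
  assumes couple: "i \<in> {1..m} \<Longrightarrow> power_couple (X i) (A i) (pt i) (\<rho> i)"
    and pow: "power_sequence m c"
begin

abbreviation "P \<equiv> polyhedral_set m X A"
abbreviation "Z \<equiv> polyhedral_simplex m X A"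
abbreviation "B \<equiv> polyhedral_boundary m X A"
abbreviation "W \<equiv> weighted_simplex m X A \<rho> c"
abbreviation "Wb \<sigma> \<equiv> weighted_product m X A \<rho> c {\<tau>. \<tau> \<subset> \<sigma>}"
abbreviation "eta \<equiv> eta_simplex m X A \<rho> c"
abbreviation "etab \<equiv> eta_boundary m X A \<rho> c"
abbreviation "wt \<equiv> weight_map m \<rho> c"

lemma topspace_Z [simp]: "topspace (Z \<sigma>) = P \<sigma>"
  by (auto simp: polyhedral_simplex_def polyhedral_set_def)

lemma topspace_polyhedral_product: "topspace (polyhedral_product m X A K) = (\<Union>\<sigma>\<in>K. P \<sigma>)"
  by (simp add: polyhedral_product_def)

lemma P_mono: "\<tau> \<subseteq> \<sigma> \<Longrightarrow> P \<tau> \<subseteq> P \<sigma>"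
  by (auto simp: polyhedral_set_def)

lemma P_Int: "P \<sigma> \<inter> P \<tau> = P (\<sigma> \<inter> \<tau>)"
  by (auto simp: polyhedral_set_def)

lemma k_space_Z: "k_space (Z \<sigma>)"
  by (simp add: polyhedral_simplex_def)

lemma Z_incl: "\<tau> \<subseteq> \<sigma> \<Longrightarrow> continuous_map (Z \<tau>) (Z \<sigma>) (\<lambda>x. x)"
  unfolding polyhedral_simplex_def
  by (rule continuous_map_kification)
     (use P_mono[of \<tau> \<sigma>] in \<open>auto simp: continuous_map_in_subtopology topspace_subtopology\<close>)

lemma B_incl: "continuous_map (B \<sigma>) (Z \<sigma>) (\<lambda>x. x)"
  by (simp add: polyhedral_product_def continuous_map_from_colim Z_incl psubset_imp_subset)

lemma quot_ge_1:
  assumes "\<tau> \<subseteq> \<sigma>" "\<sigma> \<subseteq> {1..m}" "i \<in> {1..m}"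
  shows "c \<sigma> i div c \<tau> i \<ge> 1"
proof -
  have "c \<tau> i dvd c \<sigma> i" "c \<sigma> i \<ge> 1" "c \<tau> i \<ge> 1"
    using pow assms unfolding power_sequence_def by (blast, blast, meson order_trans)
  then show ?thesis by (metis dvd_imp_le div_greater_zero_iff less_eq_Suc_le One_nat_def zero_less_one order_less_le_trans)
qed

lemma wt_continuous:
  assumes "\<tau> \<subseteq> \<sigma>" "\<sigma> \<subseteq> {1..m}"
  shows "continuous_map (Z \<upsilon>) (Z \<upsilon>) (wt \<sigma> \<tau>)"
proof -
  let ?P = "product_topology X {1..m}"
  have \<rho>: "continuous_map (X i) (X i) (\<rho> i (c \<sigma> i div c \<tau> i))"
      "x \<in> A i \<Longrightarrow> \<rho> i (c \<sigma> i div c \<tau> i) x \<in> A i" if "i \<in> {1..m}" for i x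
    using couple[OF that] quot_ge_1[OF assms that] unfolding power_couple_def by blast+
  have "continuous_map ?P ?P (wt \<sigma> \<tau>)"
    unfolding continuous_map_componentwise
  proof (intro conjI ballI)
    show "wt \<sigma> \<tau> ` topspace ?P \<subseteq> extensional {1..m}"
      by (auto simp: weight_map_def)
    fix k assume k: "k \<in> {1..m}"
    have "continuous_map ?P (X k) (\<rho> k (c \<sigma> k div c \<tau> k) \<circ> (\<lambda>x. x k))"
      using \<rho>(1)[OF k] continuous_map_product_projection[OF k] by (rule continuous_map_compose[rotated])
    then show "continuous_map ?P (X k) (\<lambda>x. wt \<sigma> \<tau> x k)"
      using k by (simp add: weight_map_def o_def)
  qed
  then have "continuous_map (kification ?P) (kification ?P) (wt \<sigma> \<tau>)"
    by (rule continuous_map_kification)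
  moreover have "wt \<sigma> \<tau> ` P \<upsilon> \<subseteq> P \<upsilon>"
    using \<rho> unfolding polyhedral_set_def weight_map_def continuous_map_def
    by (auto simp: PiE_iff Pi_iff)
  ultimately show ?thesis
    unfolding polyhedral_simplex_def
    by (intro continuous_map_kification)
       (auto simp: continuous_map_in_subtopology continuous_map_from_subtopology)
qed

lemma wt_in: "\<tau> \<subseteq> \<sigma> \<Longrightarrow> \<sigma> \<subseteq> {1..m} \<Longrightarrow> x \<in> P \<upsilon> \<Longrightarrow> wt \<sigma> \<tau> x \<in> P \<upsilon>"
  using wt_continuous[of \<tau> \<sigma> \<upsilon>] by (auto simp: continuous_map_def)

lemma wt_comp:
  assumes "\<upsilon> \<subseteq> \<tau>" "\<tau> \<subseteq> \<sigma>" "\<sigma> \<subseteq> {1..m}" "x \<in> P \<phi>"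
  shows "wt \<tau> \<upsilon> (wt \<sigma> \<tau> x) = wt \<sigma> \<upsilon> x"
proof
  fix i
  show "wt \<tau> \<upsilon> (wt \<sigma> \<tau> x) i = wt \<sigma> \<upsilon> x i"
  proof (cases "i \<in> {1..m}")
    case True
    have "c \<upsilon> i dvd c \<tau> i" "c \<tau> i dvd c \<sigma> i"
      using pow assms True unfolding power_sequence_def by (meson order_trans)+
    moreover have "c \<tau> i \<ge> 1" 
      using pow assms True unfolding power_sequence_def by (meson order_trans)
    ultimately have "(c \<tau> i div c \<upsilon> i) * (c \<sigma> i div c \<tau> i) = c \<sigma> i div c \<upsilon> i"
      by (metis div_mult_swap dvd_div_mult_self mult.commute)
    moreover have "x i \<in> topspace (X i)" using assms(4) True by (auto simp: polyhedral_set_def)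
    moreover have "c \<tau> i div c \<upsilon> i \<ge> 1" "c \<sigma> i div c \<tau> i \<ge> 1"
      using quot_ge_1 assms True by (meson order_trans)+
    ultimately show ?thesis
      using couple[OF True] True unfolding weight_map_def power_couple_def by fastforce
  qed (auto simp: weight_map_def)
qed

lemma eta_eq:
  "finite \<sigma> \<Longrightarrow> \<sigma> \<noteq> {} \<Longrightarrow> eta \<sigma> = pushout_map (B \<sigma>) (etab \<sigma>)"
  by (rule ext, subst eta_simplex.simps) (simp add: eta_boundary_def)

lemma W_eq:
  "finite \<sigma> \<Longrightarrow> \<sigma> \<noteq> {} \<Longrightarrow> W \<sigma> = pushout_top (Z \<sigma>) (B \<sigma>) (etab \<sigma>) (Wb \<sigma>)"
  by (subst weighted_simplex.simps) (simp add: weighted_product_def)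

lemma eta_empty [simp]: "eta {} x = x" and W_empty [simp]: "W {} = Z {}"
  by (subst eta_simplex.simps, simp) (subst weighted_simplex.simps, simp)

text \<open>
  If the maps \<open>\<eta>(\<tau>)\<close> for the faces \<open>\<tau> \<in> T\<close> are natural, then the maps \<open>\<eta>(\<tau>) \<circ> c\<^sup>\<omega>\<^sup>/\<^sup>\<tau>\<close>
  are compatible.
\<close>

lemma induced_eta:
  assumes T: "\<And>\<sigma> \<tau>. \<sigma> \<in> T \<Longrightarrow> \<tau> \<subseteq> \<sigma> \<Longrightarrow> \<tau> \<in> T" and \<omega>: "\<And>\<tau>. \<tau> \<in> T \<Longrightarrow> \<tau> \<subseteq> \<omega>" "\<omega> \<subseteq> {1..m}"
    and nat: "\<And>\<tau> \<upsilon> x. \<tau> \<in> T \<Longrightarrow> \<upsilon> \<subseteq> \<tau> \<Longrightarrow> x \<in> P \<upsilon> \<Longrightarrow> eta \<tau> x = eta \<upsilon> (wt \<tau> \<upsilon> x)"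
    and x: "\<tau> \<in> T" "x \<in> P \<tau>"
  shows "induced_map T P (\<lambda>\<tau> y. eta \<tau> (wt \<omega> \<tau> y)) x = eta \<tau> (wt \<omega> \<tau> x)"
  unfolding induced_map_def
proof (rule the_equality)
  show "\<forall>\<tau>'\<in>T. x \<in> P \<tau>' \<longrightarrow> eta \<tau> (wt \<omega> \<tau> x) = eta \<tau>' (wt \<omega> \<tau>' x)"
  proof (intro ballI impI)
    fix \<tau>' assume \<tau>': "\<tau>' \<in> T" "x \<in> P \<tau>'"
    then have xi: "x \<in> P (\<tau> \<inter> \<tau>')" using x P_Int by blast
    have "eta \<tau>'' (wt \<omega> \<tau>'' x) = eta (\<tau> \<inter> \<tau>') (wt \<omega> (\<tau> \<inter> \<tau>') x)"
      if "\<tau>'' \<in> T" "\<tau> \<inter> \<tau>' \<subseteq> \<tau>''" for \<tau>''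
      using nat[OF that wt_in[OF \<omega>(1)[OF that(1)] \<omega>(2) xi]]
        wt_comp[OF that(2) \<omega>(1)[OF that(1)] \<omega>(2) xi] by simp
    then show "eta \<tau> (wt \<omega> \<tau> x) = eta \<tau>' (wt \<omega> \<tau>' x)"
      using x(1) \<tau>'(1) by (metis inf_le1 inf_le2)
  qed
qed (use x in blast)

lemma wt_self:
  assumes "\<sigma> \<subseteq> {1..m}" "x \<in> P \<phi>"
  shows "wt \<sigma> \<sigma> x = x"
proof
  fix i
  show "wt \<sigma> \<sigma> x i = x i"
  proof (cases "i \<in> {1..m}")
    case True
    have "c \<sigma> i \<ge> 1" using pow assms(1) True unfolding power_sequence_def by blast
    then have "c \<sigma> i div c \<sigma> i = 1" by simp
    moreover have "x i \<in> topspace (X i)" using assms(2) True by (auto simp: polyhedral_set_def)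
    moreover have "\<forall>x\<in>topspace (X i). \<rho> i 1 x = x"
      using couple[OF True] unfolding power_couple_def by blast
    ultimately show ?thesis using True by (simp add: weight_map_def)
  next
    case False
    then have "x i = undefined" using assms(2) by (auto simp: polyhedral_set_def PiE_iff extensional_def)
    then show ?thesis using False by (auto simp: weight_map_def)
  qed
qed

lemma eta_natural:
  "\<sigma> \<subseteq> {1..m} \<Longrightarrow> \<upsilon> \<subseteq> \<sigma> \<Longrightarrow> x \<in> P \<upsilon> \<Longrightarrow> eta \<sigma> x = eta \<upsilon> (wt \<sigma> \<upsilon> x)"
proof (induction "card \<sigma>" arbitrary: \<sigma> \<upsilon> x rule: less_induct)
  case less
  have fin: "finite \<sigma>" using less.prems finite_subset by blast
  show ?case
  proof (cases "\<upsilon> = \<sigma>")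
    case True
    then show ?thesis using less.prems wt_self by simp
  next
    case False
    then have ps: "\<upsilon> \<subset> \<sigma>" "\<sigma> \<noteq> {}" using less.prems by auto
    have "x \<in> topspace (B \<sigma>)"
      using less.prems ps by (auto simp: topspace_polyhedral_product)
    then have "eta \<sigma> x = etab \<sigma> x"
      using eta_eq[OF fin ps(2)] by (simp add: pushout_map_def)
    also have "\<dots> = eta \<upsilon> (wt \<sigma> \<upsilon> x)"
      unfolding eta_boundary_def
    proof (rule induced_eta)
      fix \<tau> \<upsilon> x assume "\<tau> \<in> {\<tau>. \<tau> \<subset> \<sigma>}" "\<upsilon> \<subseteq> \<tau>" "x \<in> P \<upsilon>"
      then show "eta \<tau> x = eta \<upsilon> (wt \<tau> \<upsilon> x)"
        using less.hyps[of \<tau> \<upsilon> x] less.prems fin by (auto simp: psubset_card_mono)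
    qed (use less.prems ps in auto)
    finally show ?thesis .
  qed
qed

lemma etab_eq:
  assumes "\<sigma> \<subseteq> {1..m}" "\<tau> \<subset> \<sigma>" "x \<in> P \<tau>"
  shows "etab \<sigma> x = eta \<tau> (wt \<sigma> \<tau> x)"
  unfolding eta_boundary_def
  by (rule induced_eta) (use assms eta_natural in auto)

theorem eta_product_eq:
  assumes "complex_on m K" "\<sigma> \<in> K" "x \<in> P \<sigma>"
  shows "eta_product m X A \<rho> c K x = eta \<sigma> (wt (\<Union>K) \<sigma> x)"
  unfolding eta_product_def
  by (rule induced_eta) (use assms eta_natural in \<open>auto simp: complex_on_def\<close>)

lemma weighted_step:
  "\<sigma> \<subseteq> {1..m} \<Longrightarrow>
     topspace (W \<sigma>) = P \<sigma> \<and> k_space (W \<sigma>) \<and> continuous_map (Z \<sigma>) (W \<sigma>) (eta \<sigma>) \<and>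
     (\<sigma> \<noteq> {} \<longrightarrow> topspace (Wb \<sigma>) = topspace (B \<sigma>) \<and> k_space (Wb \<sigma>) \<and>
        continuous_map (B \<sigma>) (Wb \<sigma>) (etab \<sigma>) \<and> continuous_map (Wb \<sigma>) (W \<sigma>) (\<lambda>x. x))"
proof (induction "card \<sigma>" arbitrary: \<sigma> rule: less_induct)
  case less
  have fin: "finite \<sigma>" using less.prems finite_subset by blast
  show ?case
  proof (cases "\<sigma> = {}")
    case True
    then show ?thesis by (auto simp: k_space_Z intro!: continuous_map_eq[OF continuous_map_id])
  next
    case False
    have IH: "topspace (W \<tau>) = P \<tau>" "k_space (W \<tau>)" "continuous_map (Z \<tau>) (W \<tau>) (eta \<tau>)"
      if "\<tau> \<subset> \<sigma>" for \<tau>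
      using less.hyps[of \<tau>] less.prems that fin by (auto simp: psubset_card_mono)
    have tb: "topspace (Wb \<sigma>) = topspace (B \<sigma>)"
      using IH by (auto simp: weighted_product_def topspace_polyhedral_product)
    have kb: "k_space (Wb \<sigma>)"
      unfolding weighted_product_def by (rule k_space_colim_top) (use IH in auto)
    have "continuous_map (Z \<tau>) (Wb \<sigma>) (etab \<sigma>)" if \<tau>: "\<tau> \<subset> \<sigma>" for \<tau>
    proof -
      have "continuous_map (Z \<tau>) (W \<tau>) (eta \<tau> \<circ> wt \<sigma> \<tau>)"
        using wt_continuous IH(3)[OF \<tau>] less.prems \<tau> by (blast intro: continuous_map_compose)
      moreover have "continuous_map (W \<tau>) (Wb \<sigma>) (\<lambda>x. x)"
        unfolding weighted_product_def using \<tau> by (intro continuous_map_into_colim) auto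
      ultimately have "continuous_map (Z \<tau>) (Wb \<sigma>) ((\<lambda>x. x) \<circ> (eta \<tau> \<circ> wt \<sigma> \<tau>))"
        by (rule continuous_map_compose)
      then show ?thesis
        by (rule continuous_map_eq) (simp add: etab_eq[OF less.prems \<tau>])
    qed
    then have cb: "continuous_map (B \<sigma>) (Wb \<sigma>) (etab \<sigma>)"
      unfolding polyhedral_product_def continuous_map_from_colim by blast
    then have im: "etab \<sigma> ` topspace (B \<sigma>) \<subseteq> topspace (Wb \<sigma>)"
      by (auto simp: continuous_map_def)
    have BZ: "topspace (B \<sigma>) \<subseteq> P \<sigma>"
      using P_mono by (auto simp: topspace_polyhedral_product)
    show ?thesis
      using continuous_map_into_pushout[OF im, of "Z \<sigma>"] topspace_pushout_top[OF im, of "Z \<sigma>"]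
        k_space_pushout_top[OF im kb k_space_Z[of \<sigma>]] tb kb cb BZ
      by (auto simp: W_eq[OF fin False] eta_eq[OF fin False])
  qed
qed

text \<open>The inclusions make \<open>\<sigma> \<mapsto> (X,A)\<^sup>\<sigma>\<^sup>,\<^sup>c\<close> a functor on the face poset.\<close>

theorem W_incl:
  assumes "\<sigma> \<subseteq> {1..m}" "\<tau> \<subseteq> \<sigma>"
  shows "continuous_map (W \<tau>) (W \<sigma>) (\<lambda>x. x)"
proof (cases "\<tau> = \<sigma>")
  case False
  then have "\<tau> \<subset> \<sigma>" "\<sigma> \<noteq> {}" using assms by auto
  then have "continuous_map (W \<tau>) (Wb \<sigma>) (\<lambda>x. x)"
    unfolding weighted_product_def by (intro continuous_map_into_colim) auto
  moreover have "continuous_map (Wb \<sigma>) (W \<sigma>) (\<lambda>x. x)"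
    using weighted_step assms \<open>\<sigma> \<noteq> {}\<close> by blast
  ultimately show ?thesis
    using continuous_map_compose[of "W \<tau>" "Wb \<sigma>" "\<lambda>x. x" "W \<sigma>" "\<lambda>x. x"] by (simp add: o_def)
qed simp

text \<open>\<open>(X,A)\<^sup>\<sigma>\<^sup>,\<^sup>c\<close> is the pushout of \<open>(X,A)\<^sup>\<partial>\<^sup>\<sigma> \<rightarrow> (X,A)\<^sup>\<sigma>\<close> and \<open>\<eta>(\<partial>\<sigma>)\<close>, with structure map \<open>\<eta>(\<sigma>)\<close>.\<close>

theorem weighted_simplex_pushout:
  assumes \<sigma>: "\<sigma> \<subseteq> {1..m}" "\<sigma> \<noteq> {}"
  shows "continuous_map (B \<sigma>) (Z \<sigma>) (\<lambda>x. x)" "continuous_map (B \<sigma>) (Wb \<sigma>) (etab \<sigma>)"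
    "continuous_map (Z \<sigma>) (W \<sigma>) (eta \<sigma>)" "continuous_map (Wb \<sigma>) (W \<sigma>) (\<lambda>x. x)"
    "\<And>x. x \<in> topspace (B \<sigma>) \<Longrightarrow> eta \<sigma> x = etab \<sigma> x"
    "topspace (W \<sigma>) = topspace (Wb \<sigma>) \<union> eta \<sigma> ` topspace (Z \<sigma>)"
    "\<And>V g h. continuous_map (Wb \<sigma>) V g \<Longrightarrow> continuous_map (Z \<sigma>) V h \<Longrightarrow>
        (\<And>x. x \<in> topspace (B \<sigma>) \<Longrightarrow> g (etab \<sigma> x) = h x) \<Longrightarrow>
        \<exists>k. continuous_map (W \<sigma>) V k \<and> (\<forall>y\<in>topspace (Wb \<sigma>). k y = g y) \<and>
            (\<forall>z\<in>topspace (Z \<sigma>). k (eta \<sigma> z) = h z)"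
proof -
  have fin: "finite \<sigma>" using \<sigma> finite_subset by blast
  note st = weighted_step[OF \<sigma>(1)] 
  show "continuous_map (B \<sigma>) (Z \<sigma>) (\<lambda>x. x)" by (rule B_incl)
  show cb: "continuous_map (B \<sigma>) (Wb \<sigma>) (etab \<sigma>)"
    and "continuous_map (Z \<sigma>) (W \<sigma>) (eta \<sigma>)" "continuous_map (Wb \<sigma>) (W \<sigma>) (\<lambda>x. x)"
    using st \<sigma>(2) by blast+
  show e: "eta \<sigma> x = etab \<sigma> x" if "x \<in> topspace (B \<sigma>)" for x
    using that eta_eq[OF fin \<sigma>(2)] by (simp add: pushout_map_def)
  have im: "etab \<sigma> ` topspace (B \<sigma>) \<subseteq> topspace (Wb \<sigma>)"
    using cb by (auto simp: continuous_map_def)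
  have BZ: "topspace (B \<sigma>) \<subseteq> topspace (Z \<sigma>)"
    using P_mono by (auto simp: topspace_polyhedral_product)
  have disj: "topspace (Wb \<sigma>) \<inter> (topspace (Z \<sigma>) - topspace (B \<sigma>)) = {}"
    using st \<sigma>(2) by auto
  have "eta \<sigma> ` topspace (Z \<sigma>) \<subseteq> topspace (W \<sigma>)"
    using st by (auto simp: continuous_map_def)
  moreover have "topspace (Z \<sigma>) - topspace (B \<sigma>) \<subseteq> eta \<sigma> ` topspace (Z \<sigma>)"
    by (force simp: eta_eq[OF fin \<sigma>(2)] pushout_map_def)
  ultimately show "topspace (W \<sigma>) = topspace (Wb \<sigma>) \<union> eta \<sigma> ` topspace (Z \<sigma>)"
    using topspace_pushout_top[OF im, of "Z \<sigma>"] by (auto simp: W_eq[OF fin \<sigma>(2)])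
  fix V :: "'c topology" and g h
  assume "continuous_map (Wb \<sigma>) V g" "continuous_map (Z \<sigma>) V h"
    "\<And>x. x \<in> topspace (B \<sigma>) \<Longrightarrow> g (etab \<sigma> x) = h x"
  then obtain k where "continuous_map (pushout_top (Z \<sigma>) (B \<sigma>) (etab \<sigma>) (Wb \<sigma>)) V k"
    "\<And>y. y \<in> topspace (Wb \<sigma>) \<Longrightarrow> k y = g y"
    "\<And>z. z \<in> topspace (Z \<sigma>) \<Longrightarrow> k (pushout_map (B \<sigma>) (etab \<sigma>) z) = h z"
    using pushout_universal[OF im BZ disj] by metis
  then show "\<exists>k. continuous_map (W \<sigma>) V k \<and> (\<forall>y\<in>topspace (Wb \<sigma>). k y = g y) \<and>
            (\<forall>z\<in>topspace (Z \<sigma>). k (eta \<sigma> z) = h z)"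
    by (auto simp: W_eq[OF fin \<sigma>(2)] eta_eq[OF fin \<sigma>(2)])
qed

text \<open>
  \<open>(X,A)\<^sup>K\<^sup>,\<^sup>c\<close> is the colimit of the \<open>(X,A)\<^sup>\<sigma>\<^sup>,\<^sup>c\<close>; the case \<open>K = {\<tau>. \<tau> \<subset> \<sigma>}\<close> is included.
\<close>

theorem weighted_product_colimit:
  assumes K: "K \<subseteq> Pow {1..m}" "\<And>\<sigma> \<tau>. \<sigma> \<in> K \<Longrightarrow> \<tau> \<subseteq> \<sigma> \<Longrightarrow> \<tau> \<in> K"
  shows "k_space (weighted_product m X A \<rho> c K)"
    "\<And>\<sigma>. \<sigma> \<in> K \<Longrightarrow> continuous_map (W \<sigma>) (weighted_product m X A \<rho> c K) (\<lambda>x. x)"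
    "topspace (weighted_product m X A \<rho> c K) = (\<Union>\<sigma>\<in>K. topspace (W \<sigma>))"
    "\<And>V g. (\<And>\<sigma>. \<sigma> \<in> K \<Longrightarrow> continuous_map (W \<sigma>) V (g \<sigma>)) \<Longrightarrow>
       (\<And>\<sigma> \<tau> x. \<sigma> \<in> K \<Longrightarrow> \<tau> \<subseteq> \<sigma> \<Longrightarrow> x \<in> topspace (W \<tau>) \<Longrightarrow> g \<sigma> x = g \<tau> x) \<Longrightarrow>
       \<exists>k. continuous_map (weighted_product m X A \<rho> c K) V k \<and>
           (\<forall>\<sigma>\<in>K. \<forall>x\<in>topspace (W \<sigma>). k x = g \<sigma> x)"
proof -
  have t: "topspace (W \<sigma>) = P \<sigma>" "k_space (W \<sigma>)" if "\<sigma> \<in> K" for \<sigma>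
    using weighted_step[of \<sigma>] K(1) that by auto
  show "k_space (weighted_product m X A \<rho> c K)"
    unfolding weighted_product_def by (rule k_space_colim_top) (use t in auto)
  show "continuous_map (W \<sigma>) (weighted_product m X A \<rho> c K) (\<lambda>x. x)" if "\<sigma> \<in> K" for \<sigma>
    unfolding weighted_product_def using that by (rule continuous_map_into_colim)
  show "topspace (weighted_product m X A \<rho> c K) = (\<Union>\<sigma>\<in>K. topspace (W \<sigma>))"
    by (simp add: weighted_product_def)
  fix V :: "'c topology" and g
  assume g: "\<And>\<sigma>. \<sigma> \<in> K \<Longrightarrow> continuous_map (W \<sigma>) V (g \<sigma>)"
    and comp: "\<And>\<sigma> \<tau> x. \<sigma> \<in> K \<Longrightarrow> \<tau> \<subseteq> \<sigma> \<Longrightarrow> x \<in> topspace (W \<tau>) \<Longrightarrow> g \<sigma> x = g \<tau> x"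
  define k where "k = induced_map K P g"
  have k: "k x = g \<sigma> x" if s: "\<sigma> \<in> K" "x \<in> P \<sigma>" for \<sigma> x
    unfolding k_def induced_map_def
  proof (rule the_equality)
    show "\<forall>\<tau>\<in>K. x \<in> P \<tau> \<longrightarrow> g \<sigma> x = g \<tau> x"
    proof (intro ballI impI)
      fix \<tau> assume \<tau>: "\<tau> \<in> K" "x \<in> P \<tau>"
      have "\<sigma> \<inter> \<tau> \<in> K" using K(2)[OF s(1)] by blast
      moreover have "x \<in> P (\<sigma> \<inter> \<tau>)" using s \<tau> P_Int by blast
      ultimately have "x \<in> topspace (W (\<sigma> \<inter> \<tau>))" using t by simp
      then show "g \<sigma> x = g \<tau> x"
        using comp[OF s(1), of "\<sigma> \<inter> \<tau>" x] comp[OF \<tau>(1), of "\<sigma> \<inter> \<tau>" x] by simp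
    qed
  qed (use s in blast)
  have "continuous_map (weighted_product m X A \<rho> c K) V k"
    unfolding weighted_product_def continuous_map_from_colim
    using continuous_map_eq[OF g] k t by fastforce
  then show "\<exists>k. continuous_map (weighted_product m X A \<rho> c K) V k \<and>
           (\<forall>\<sigma>\<in>K. \<forall>x\<in>topspace (W \<sigma>). k x = g \<sigma> x)"
    using k t by auto
qed

theorem eta_product_continuous:
  assumes K: "complex_on m K"
  shows "continuous_map (polyhedral_product m X A K) (weighted_product m X A \<rho> c K) (eta_product m X A \<rho> c K)"
  unfolding polyhedral_product_def continuous_map_from_colim
proof
  fix \<sigma> assume \<sigma>: "\<sigma> \<in> K"
  then have sub: "\<sigma> \<subseteq> \<Union>K" "\<Union>K \<subseteq> {1..m}" "\<sigma> \<subseteq> {1..m}" using K by (auto simp: complex_on_def)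
  have "continuous_map (Z \<sigma>) (W \<sigma>) (eta \<sigma> \<circ> wt (\<Union>K) \<sigma>)"
    using wt_continuous[OF sub(1,2)] weighted_step[OF sub(3)] by (blast intro: continuous_map_compose)
  moreover have "continuous_map (W \<sigma>) (weighted_product m X A \<rho> c K) (\<lambda>x. x)"
    unfolding weighted_product_def using \<sigma> by (rule continuous_map_into_colim)
  ultimately have "continuous_map (Z \<sigma>) (weighted_product m X A \<rho> c K) ((\<lambda>x. x) \<circ> (eta \<sigma> \<circ> wt (\<Union>K) \<sigma>))"
    by (rule continuous_map_compose)
  then show "continuous_map (Z \<sigma>) (weighted_product m X A \<rho> c K) (eta_product m X A \<rho> c K)"
    by (rule continuous_map_eq) (simp add: eta_product_eq[OF K \<sigma>])
qed

text \<open>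
  If the \<open>A\<^sub>i\<close> are closed, the colimit topology on \<open>(X,A)\<^sup>K\<close> is the subspace topology
  inherited from the product.
\<close>

theorem polyhedral_product_subspace:
  assumes K: "complex_on m K" and closed: "\<And>i. i \<in> {1..m} \<Longrightarrow> closedin (X i) (A i)"
  shows "polyhedral_product m X A K =
    subtopology (kification (product_topology X {1..m})) (\<Union>\<sigma>\<in>K. P \<sigma>)"
proof -
  let ?Q = "kification (product_topology X {1..m})"
  have cl: "closedin ?Q (P \<sigma>)" for \<sigma>
  proof -
    let ?R = "\<Pi>\<^sub>E i\<in>{1..m}. if i \<in> \<sigma> then topspace (X i) else A i"
    have sub: "A i \<subseteq> topspace (X i)" if "i \<in> {1..m}" for i
      using closed[OF that] closedin_subset by blast
    have "P \<sigma> = ?R"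
    proof
      show "P \<sigma> \<subseteq> ?R" by (auto simp: polyhedral_set_def PiE_iff extensional_def)
      show "?R \<subseteq> P \<sigma>"
      proof
        fix x assume x: "x \<in> ?R"
        have "x i \<in> topspace (X i)" if "i \<in> {1..m}" for i
          using PiE_mem[OF x that] sub[OF that] by (cases "i \<in> \<sigma>") auto
        moreover have "x i \<in> A i" if "i \<in> {1..m} - \<sigma>" for i
          using PiE_mem[OF x, of i] that by simp
        ultimately show "x \<in> P \<sigma>" using x unfolding polyhedral_set_def PiE_iff by blast
      qed
    qed
    moreover have "closedin (product_topology X {1..m}) ?R"
      using closed by (simp add: closedin_product_topology)
    ultimately show ?thesis using closedin_kification_finer by metis
  qed
  then have Z: "Z \<sigma> = subtopology ?Q (P \<sigma>)" for \<sigma>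
    unfolding polyhedral_simplex_def kification_eq_self
    by (intro k_space_closed_subtopology) auto
  have fin: "finite K" using K finite_subset[of K "Pow {1..m}"] by (auto simp: complex_on_def)
  let ?U = "\<Union>\<sigma>\<in>K. P \<sigma>"
  have closed_colim: "closedin (colim_top K Z) C \<longleftrightarrow> C \<subseteq> ?U \<and> (\<forall>\<sigma>\<in>K. closedin (Z \<sigma>) (C \<inter> P \<sigma>))" for C
  proof -
    have "(?U - C) \<inter> P \<sigma> = P \<sigma> - C \<inter> P \<sigma>" if "\<sigma> \<in> K" for \<sigma> using that by blast
    then show ?thesis by (auto simp: closedin_def openin_colim_top)
  qed
  have "closedin (colim_top K Z) C \<longleftrightarrow> closedin (subtopology ?Q ?U) C" for C
  proof
    assume "closedin (colim_top K Z) C"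
    then have C: "C \<subseteq> ?U" "\<And>\<sigma>. \<sigma> \<in> K \<Longrightarrow> closedin ?Q (C \<inter> P \<sigma>)"
      using cl by (auto simp: closed_colim Z closedin_closed_subtopology)
    then have "closedin ?Q (\<Union>\<sigma>\<in>K. C \<inter> P \<sigma>)" using fin by (intro closedin_Union) auto
    moreover have "(\<Union>\<sigma>\<in>K. C \<inter> P \<sigma>) = C" using C(1) by blast
    ultimately show "closedin (subtopology ?Q ?U) C" using C(1) by (metis closedin_subset_topspace)
  next
    assume "closedin (subtopology ?Q ?U) C"
    then obtain D where D: "closedin ?Q D" "C = D \<inter> ?U" by (auto simp: closedin_subtopology)
    have "C \<inter> P \<sigma> = D \<inter> P \<sigma>" if "\<sigma> \<in> K" for \<sigma> using that D(2) by blast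
    then show "closedin (colim_top K Z) C"
      using D by (auto simp: closed_colim Z closedin_subtopology)
  qed
  then show ?thesis
    unfolding polyhedral_product_def topology_eq openin_closedin_eq
    by (metis (no_types, lifting) closedin_topspace topspace_colim_top closedin_subset subset_antisym)
qed

end

end

theory Submission
  imports Defs
begin

text \<open>
  A power map \<open>\<rho>\<^sub>a\<close> acts trivially on a coordinate for one of two reasons: \<open>a = 1\<close>, or the
  coordinate is the basepoint.  For a minimal power sequence and \<open>A\<^sub>i = *\<close>, every coordinate of a
  point of \<open>(X,*)\<^sup>\<tau>\<close> falls under one of them when \<open>c\<^sup>\<sigma>\<^sup>/\<^sup>\<tau>\<close> is applied.  If \<open>i \<in> \<tau>\<close>, then the
  exponent is \<open>c\<^sub>i\<^sup>\<sigma> / c\<^sub>i\<^sup>\<tau> = 1\<close>, because both terms are the weight of the vertex \<open>i\<close>; if \<open>i \<notin> \<tau>\<close>,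
  then the coordinate is the basepoint.  So \<open>c\<^sup>\<sigma>\<^sup>/\<^sup>\<tau>\<close> restricts to the identity of \<open>(X,*)\<^sup>\<tau>\<close>
  (\<open>weight_map_identity\<close>).

  The twisting maps are the only source of a difference between the two constructions.  By induction
  on \<open>|\<sigma>|\<close>, the map \<open>\<eta>(\<partial>\<sigma>)\<close> is glued from identities, so \<open>(X,*)\<^sup>\<sigma>\<^sup>,\<^sup>c\<close> is a pushout of
  \<open>(X,*)\<^sup>\<sigma>\<close> along an identity map, which changes nothing (\<open>pushout_along_identity\<close>).  Gluing
  over the faces of \<open>K\<close> gives the claim.
\<close>

lemma pushout_along_identity:
  assumes incl: "continuous_map B Z (\<lambda>x. x)"
    and id: "\<And>b. b \<in> topspace B \<Longrightarrow> f b = b"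
  shows "pushout_top Z B f B = Z"
proof -
  have BZ: "topspace B \<subseteq> topspace Z"
    using incl by (auto simp: continuous_map_def)
  have preimage: "{z \<in> topspace Z. pushout_map B f z \<in> U} = U \<inter> topspace Z" for U
    using id by (auto simp: pushout_map_def)
  have "openin (pushout_top Z B f B) U \<longleftrightarrow> openin Z U" for U
  proof
    assume "openin (pushout_top Z B f B) U"
    then have "U \<subseteq> topspace Z" "openin Z (U \<inter> topspace Z)"
      using BZ by (auto simp: openin_pushout_top preimage)
    then show "openin Z U" by (simp add: Int_absorb2)
  next
    assume U: "openin Z U"
    then have "openin B {x \<in> topspace B. x \<in> U}"
      using incl by (simp add: continuous_map_def)
    then have "openin B (U \<inter> topspace B)"
      by (simp add: Int_def conj_commute)
    then show "openin (pushout_top Z B f B) U"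
      using U openin_subset[OF U] by (auto simp: openin_pushout_top preimage)
  qed
  then show ?thesis by (simp add: topology_eq)
qed

locale minimal_pointed_data = weighted_data m X "\<lambda>i. {pt i}" pt \<rho> c
  for m :: nat and X :: "nat \<Rightarrow> 'a topology" and pt :: "nat \<Rightarrow> 'a"
    and \<rho> :: "nat \<Rightarrow> nat \<Rightarrow> 'a \<Rightarrow> 'a" and c :: "nat set \<Rightarrow> nat \<Rightarrow> nat" +
  assumes minimal: "minimal_power_sequence m c"
begin

text \<open>
  The identity holds only on \<open>(X,*)\<^sup>\<tau>\<close>: at the vertices of \<open>\<sigma>\<close> outside \<open>\<tau>\<close> the exponents
  need not be \<open>1\<close>, and it is the basepoint that is fixed there.
\<close>

lemma weight_map_identity:
  assumes sub: "\<tau> \<subseteq> \<sigma>" "\<sigma> \<subseteq> {1..m}" and x: "x \<in> P \<tau>"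
  shows "wt \<sigma> \<tau> x = x"
proof
  fix i
  show "wt \<sigma> \<tau> x i = x i"
  proof (cases "i \<in> {1..m}")
    case i: True
    note \<rho> = couple[OF i, unfolded power_couple_def]
    have "\<rho> i (c \<sigma> i div c \<tau> i) (x i) = x i"
    proof (cases "i \<in> \<tau>")
      case True
      have "c \<upsilon> i = c {i} i" if "\<upsilon> \<subseteq> {1..m}" "i \<in> \<upsilon>" for \<upsilon>
        using minimal that unfolding minimal_power_sequence_def by blast
      then have "c \<sigma> i = c \<tau> i" using sub True by (metis subset_iff)
      moreover have "c \<sigma> i div c \<tau> i \<ge> 1" using quot_ge_1[OF sub i] .
      ultimately have "c \<sigma> i div c \<tau> i = 1" by (cases "c \<tau> i = 0") auto
      moreover have "x i \<in> topspace (X i)" using x i by (auto simp: polyhedral_set_def)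
      ultimately show ?thesis using \<rho> by simp
    next
      case False
      then have "x i = pt i" using x i by (auto simp: polyhedral_set_def)
      then show ?thesis using \<rho> quot_ge_1[OF sub i] by simp
    qed
    then show ?thesis using i by (simp add: weight_map_def)
  next
    case False
    then have "x i = undefined"
      using x by (auto simp: polyhedral_set_def PiE_iff extensional_def)
    then show ?thesis using False by (auto simp: weight_map_def)
  qed
qed

text \<open>
  A point of \<open>(X,*)\<^sup>\<sigma>\<close> outside \<open>(X,*)\<^sup>\<partial>\<^sup>\<sigma>\<close> is not moved by the pushout map, and on a proper face
  \<open>\<tau>\<close> the map \<open>\<eta>(\<sigma>)\<close> is \<open>\<eta>(\<tau>) \<circ> c\<^sup>\<sigma>\<^sup>/\<^sup>\<tau>\<close>, the second factor of which is the identity.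
\<close>

lemma eta_simplex_identity:
  "\<sigma> \<subseteq> {1..m} \<Longrightarrow> x \<in> P \<sigma> \<Longrightarrow> eta \<sigma> x = x"
proof (induction "card \<sigma>" arbitrary: \<sigma> rule: less_induct)
  case less
  have fin: "finite \<sigma>" using less.prems(1) finite_subset by blast
  consider "\<sigma> = {}" | "\<sigma> \<noteq> {}" "x \<notin> topspace (B \<sigma>)" | \<tau> where "\<tau> \<subset> \<sigma>" "x \<in> P \<tau>"
    by (auto simp: topspace_polyhedral_product)
  then show ?case
  proof cases
    case 2
    then show ?thesis by (simp add: eta_eq[OF fin] pushout_map_def)
  next
    case 3
    have "eta \<sigma> x = eta \<tau> (wt \<sigma> \<tau> x)"
      using eta_natural[OF less.prems(1)] 3 by blast
    also have "\<dots> = eta \<tau> x"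
      using weight_map_identity less.prems(1) 3 by simp
    also have "\<dots> = x"
      using less.hyps[of \<tau>] less.prems(1) 3 fin by (auto simp: psubset_card_mono)
    finally show ?thesis .
  qed simp
qed

lemma eta_boundary_identity:
  assumes "\<sigma> \<subseteq> {1..m}" "x \<in> topspace (B \<sigma>)"
  shows "etab \<sigma> x = x"
proof -
  obtain \<tau> where \<tau>: "\<tau> \<subset> \<sigma>" "x \<in> P \<tau>"
    using assms(2) by (auto simp: topspace_polyhedral_product)
  have "etab \<sigma> x = eta \<tau> (wt \<sigma> \<tau> x)" using etab_eq[OF assms(1) \<tau>] .
  also have "\<dots> = x"
    using weight_map_identity eta_simplex_identity assms(1) \<tau> by auto
  finally show ?thesis .
qed

lemma weighted_simplex_eq_polyhedral_simplex:
  "\<sigma> \<subseteq> {1..m} \<Longrightarrow> W \<sigma> = Z \<sigma>"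
proof (induction "card \<sigma>" arbitrary: \<sigma> rule: less_induct)
  case less
  have fin: "finite \<sigma>" using less.prems finite_subset by blast
  show ?case
  proof (cases "\<sigma> = {}")
    case False
    have "W \<tau> = Z \<tau>" if "\<tau> \<subset> \<sigma>" for \<tau>
      using less.hyps[of \<tau>] less.prems that fin by (auto simp: psubset_card_mono)
    then have "Wb \<sigma> = B \<sigma>"
      unfolding weighted_product_def polyhedral_product_def by (intro colim_top_cong) auto
    then show ?thesis
      using pushout_along_identity[OF B_incl eta_boundary_identity[OF less.prems]]
      by (simp add: W_eq[OF fin False])
  qed simp
qed

end

theorem lemma3p1:
  fixes m :: nat
    and X :: "nat \<Rightarrow> 'a topology"
    and pt :: "nat \<Rightarrow> 'a"
    and \<rho> :: "nat \<Rightarrow> nat \<Rightarrow> 'a \<Rightarrow> 'a"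
    and K :: "nat set set"
    and c :: "nat set \<Rightarrow> nat \<Rightarrow> nat"
  assumes "\<And>i. i \<in> {1..m} \<Longrightarrow> power_couple (X i) {pt i} (pt i) (\<rho> i)"
    and "complex_on m K"
    and "minimal_power_sequence m c"
  shows "weighted_product m X (\<lambda>i. {pt i}) \<rho> c K = polyhedral_product m X (\<lambda>i. {pt i}) K \<and>
         (\<forall>x \<in> topspace (polyhedral_product m X (\<lambda>i. {pt i}) K).
            eta_product m X (\<lambda>i. {pt i}) \<rho> c K x = x)"
proof -
  interpret minimal_pointed_data m X pt \<rho> c
    by unfold_locales (use assms in \<open>auto simp: minimal_power_sequence_def\<close>)
  have face: "\<sigma> \<subseteq> {1..m}" "\<sigma> \<subseteq> \<Union>K" "\<Union>K \<subseteq> {1..m}" if "\<sigma> \<in> K" for \<sigma>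
    using assms(2) that by (auto simp: complex_on_def)
  have "weighted_product m X (\<lambda>i. {pt i}) \<rho> c K = polyhedral_product m X (\<lambda>i. {pt i}) K"
    unfolding weighted_product_def polyhedral_product_def
    by (intro colim_top_cong refl weighted_simplex_eq_polyhedral_simplex face)
  moreover have "eta_product m X (\<lambda>i. {pt i}) \<rho> c K x = x" if \<sigma>: "\<sigma> \<in> K" "x \<in> P \<sigma>" for \<sigma> x
  proof -
    have "eta_product m X (\<lambda>i. {pt i}) \<rho> c K x = eta \<sigma> (wt (\<Union>K) \<sigma> x)"
      using eta_product_eq[OF assms(2) \<sigma>] .
    also have "\<dots> = x"
      using weight_map_identity[OF face(2,3)[OF \<sigma>(1)] \<sigma>(2)]
        eta_simplex_identity[OF face(1)[OF \<sigma>(1)] \<sigma>(2)] by simp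
    finally show ?thesis .
  qed
  ultimately show ?thesis
    unfolding topspace_polyhedral_product by blast
qed

end
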